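(* Let $N\ge 1$, $s\in(0,1)$, $1<p<2$. There exists a constant $C>0$ depending only on $N$, $p$ and $s$ such that the following holds. Let $U\subset\mathbb{R}^N_+$ be a bounded open set, let $V\in L^1_{loc}(U)$ with $V_+:=\max\{V,0\}\in L^\infty(U)$, and let $u\in \widetilde{W}^{s,p}(U)\cap\widetilde{W}^{s,p}(\mathcal{T}(U))\cap L^\infty(\mathbb{R}^N)$ be a weak solution of $$\begin{cases}(-\Delta)_p^s u-(-\Delta)_p^s u^*\ge V(x)(u-u^* ) & \text{in } U,\\ u\ge u^* & \text{in } \mathbb{R}^N_+\setminus U.\end{cases}$$ If $$|U|^{\frac{sp}{N}}\,\|V_+\|_{L^\infty(U)}\,\|u\|_{L^\infty(\mathbb{R}^N)}^{2-p}<C,$$ then $u\ge u^*$ a.e. in $U$.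
   Context: Notation: $\mathbb{R}^N_+=\{x=(x',x_N)\in\mathbb{R}^{N-1}\times\mathbb{R}: x_N>0\}$; $x^*=(x',-x_N)$; $\mathcal{T}(U)=\{x^*:x\in U\}$; $u^*(x)=u(x^* )$; $|U|$ is Lebesgue measure; $J_u(x,y)=|u(x)-u(y)|^{p-2}(u(x)-u(y))$. Equalities and inequalities between functions are understood a.e. Function spaces: $[u]_{s,p}=\left(\int_{\mathbb{R}^N}\int_{\mathbb{R}^N}\frac{|u(x)-u(y)|^p}{|x-y|^{N+sp}}\,dx\,dy\right)^{1/p}$; $W^{s,p}(\mathbb{R}^N)=\{u\in L^p(\mathbb{R}^N):[u]_{s,p}<\infty\}$ with norm $\|u\|_{L^p(\mathbb{R}^N)}+[u]_{s,p}$; for an open set $\Omega$, $W^{s,p}_0(\Omega)=\{u\in W^{s,p}(\mathbb{R}^N): u=0 \text{ in } \mathbb{R}^N\setminus\Omega\}$, with dual space $W_0^{s,p}(\Omega)'$; $$\widetilde{W}^{s,p}(\Omega)=\left\{u\in L^p_{loc}(\mathbb{R}^N):\int_\Omega\int_{\mathbb{R}^N}\frac{|u(x)-u(y)|^p}{|x-y|^{N+sp}}\,dx\,dy<\infty\right\}.$$ Operator: for $u\in\widetilde{W}^{s,p}(\Omega)$ and $\varphi\in W_0^{s,p}(\Omega)$, $$\langle(-\Delta)_p^su,\varphi\rangle=\int_{\mathbb{R}^N}\int_{\mathbb{R}^N}\frac{J_u(x,y)(\varphi(x)-\varphi(y))}{|x-y|^{N+sp}}\,dx\,dy.$$ Weak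 solution of the inequality problem: $u\in\widetilde{W}^{s,p}(U)\cap\widetilde{W}^{s,p}(\mathcal{T}(U))$ is a (weak) solution if $u\ge u^*$ in $\mathbb{R}^N_+\setminus U$, $V(u-u^* )\in W_0^{s,p}(U)'$, and $\langle(-\Delta)_p^su,\varphi\rangle-\langle(-\Delta)_p^su^*,\varphi\rangle\ge\int_UV(x)(u-u^* )\varphi\,dx$ for all $\varphi\in W_0^{s,p}(U)$ with $\varphi\ge0$. *)

theory Defs
  imports "HOL-Analysis.Analysis" "HOL-Probability.Essential_Supremum"
begin

text \<open>
  Euclidean space of dimension $N$ is the type \<open>real ^ 'n\<close>, with \<open>N = CARD('n) \<ge> 1\<close>; an index
  \<open>k :: 'n\<close> names the coordinate that plays the role of $x_N$. Functions on it are total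
  real-valued functions, measurability is Lebesgue measurability, and relations between
  functions hold almost everywhere.
\<close>

definition half_space :: "'n::finite \<Rightarrow> (real ^ 'n) set" where
  "half_space k = {x. x $ k > 0}"

definition reflect :: "'n::finite \<Rightarrow> real ^ 'n \<Rightarrow> real ^ 'n" where
  "reflect k x = (\<chi> i. if i = k then - (x $ i) else x $ i)"

definition reflect_fun :: "'n::finite \<Rightarrow> (real ^ 'n \<Rightarrow> real) \<Rightarrow> real ^ 'n \<Rightarrow> real" where
  "reflect_fun k u = (\<lambda>x. u (reflect k x))"

text \<open>The $L^\infty$ norm over \<open>A\<close> as an extended nonnegative real; on a null set it is \<open>0\<close>.\<close>

definition Linfty_norm :: "'a::euclidean_space set \<Rightarrow> ('a \<Rightarrow> real) \<Rightarrow> ennreal" where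
  "Linfty_norm A f = esssup (lebesgue_on A) (\<lambda>x. ennreal \<bar>f x\<bar>)"

definition Linfty :: "'a::euclidean_space set \<Rightarrow> ('a \<Rightarrow> real) set" where
  "Linfty A = {f. f \<in> borel_measurable (lebesgue_on A) \<and> Linfty_norm A f < \<infinity>}"

definition Lp :: "real \<Rightarrow> ('a::euclidean_space \<Rightarrow> real) set" where
  "Lp p = {f. f \<in> borel_measurable lebesgue \<and> integrable lebesgue (\<lambda>x. \<bar>f x\<bar> powr p)}"

definition Lp_norm :: "real \<Rightarrow> ('a::euclidean_space \<Rightarrow> real) \<Rightarrow> real" where
  "Lp_norm p f = (LINT x|lebesgue. \<bar>f x\<bar> powr p) powr (1 / p)"

definition Lp_loc :: "real \<Rightarrow> ('a::euclidean_space \<Rightarrow> real) set" where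
  "Lp_loc p = {f. f \<in> borel_measurable lebesgue \<and>
     (\<forall>K. compact K \<longrightarrow> (\<lambda>x. \<bar>f x\<bar> powr p) absolutely_integrable_on K)}"

definition L1_loc_on :: "'a::euclidean_space set \<Rightarrow> ('a \<Rightarrow> real) set" where
  "L1_loc_on U = {f. \<forall>K. compact K \<and> K \<subseteq> U \<longrightarrow> f absolutely_integrable_on K}"

text \<open>The double integral over \<open>A \<times> real ^ 'n\<close>. In this and the following kernels, the value on
  the null diagonal is \<open>0\<close> by the conventions \<open>0 powr a = 0\<close> and \<open>a / 0 = 0\<close>.\<close>

definition gagliardo_integral ::
    "real \<Rightarrow> real \<Rightarrow> (real ^ 'n::finite) set \<Rightarrow> (real ^ 'n \<Rightarrow> real) \<Rightarrow> ennreal" where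
  "gagliardo_integral s p A u =
     (\<integral>\<^sup>+x\<in>A. (\<integral>\<^sup>+y. ennreal (\<bar>u x - u y\<bar> powr p / norm (x - y) powr (real CARD('n) + s * p))
        \<partial>lebesgue) \<partial>lebesgue)"

definition gagliardo_seminorm :: "real \<Rightarrow> real \<Rightarrow> (real ^ 'n::finite \<Rightarrow> real) \<Rightarrow> real" where
  "gagliardo_seminorm s p u = enn2real (gagliardo_integral s p UNIV u) powr (1 / p)"

definition Wsp :: "real \<Rightarrow> real \<Rightarrow> (real ^ 'n::finite \<Rightarrow> real) set" where
  "Wsp s p = {u \<in> Lp p. gagliardo_integral s p UNIV u < \<infinity>}"

definition Wsp_norm :: "real \<Rightarrow> real \<Rightarrow> (real ^ 'n::finite \<Rightarrow> real) \<Rightarrow> real" where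
  "Wsp_norm s p u = Lp_norm p u + gagliardo_seminorm s p u"

definition Wsp0 :: "real \<Rightarrow> real \<Rightarrow> (real ^ 'n::finite) set \<Rightarrow> (real ^ 'n \<Rightarrow> real) set" where
  "Wsp0 s p \<Omega> = {u \<in> Wsp s p. AE x in lebesgue. x \<notin> \<Omega> \<longrightarrow> u x = 0}"

definition Wsp_tilde :: "real \<Rightarrow> real \<Rightarrow> (real ^ 'n::finite) set \<Rightarrow> (real ^ 'n \<Rightarrow> real) set" where
  "Wsp_tilde s p \<Omega> = {u \<in> Lp_loc p. gagliardo_integral s p \<Omega> u < \<infinity>}"

text \<open>A function \<open>f\<close> on \<open>\<Omega>\<close> belongs to the dual of \<open>Wsp0 s p \<Omega>\<close> if $\varphi \mapsto \int_\Omega f \varphi$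
  is a well-defined bounded functional there (linearity is automatic).\<close>

definition in_Wsp0_dual ::
    "real \<Rightarrow> real \<Rightarrow> (real ^ 'n::finite) set \<Rightarrow> (real ^ 'n \<Rightarrow> real) \<Rightarrow> bool" where
  "in_Wsp0_dual s p \<Omega> f \<longleftrightarrow>
     (\<forall>\<phi> \<in> Wsp0 s p \<Omega>. set_integrable lebesgue \<Omega> (\<lambda>x. f x * \<phi> x)) \<and>
     (\<exists>K. \<forall>\<phi> \<in> Wsp0 s p \<Omega>. \<bar>LINT x:\<Omega>|lebesgue. f x * \<phi> x\<bar> \<le> K * Wsp_norm s p \<phi>)"

definition J :: "real \<Rightarrow> (real ^ 'n::finite \<Rightarrow> real) \<Rightarrow> real ^ 'n \<Rightarrow> real ^ 'n \<Rightarrow> real" where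
  "J p u x y = \<bar>u x - u y\<bar> powr (p - 2) * (u x - u y)"

definition frac_p_laplacian ::
    "real \<Rightarrow> real \<Rightarrow> (real ^ 'n::finite \<Rightarrow> real) \<Rightarrow> (real ^ 'n \<Rightarrow> real) \<Rightarrow> real" where
  "frac_p_laplacian s p u \<phi> =
     (LINT x|lebesgue. LINT y|lebesgue.
        J p u x y * (\<phi> x - \<phi> y) / norm (x - y) powr (real CARD('n) + s * p))"

definition weak_solution ::
    "real \<Rightarrow> real \<Rightarrow> 'n::finite \<Rightarrow> (real ^ 'n) set \<Rightarrow> (real ^ 'n \<Rightarrow> real) \<Rightarrow> (real ^ 'n \<Rightarrow> real) \<Rightarrow> bool" where
  "weak_solution s p k U V u \<longleftrightarrow>
     u \<in> Wsp_tilde s p U \<inter> Wsp_tilde s p (reflect k ` U) \<and>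
     (AE x in lebesgue. x \<in> half_space k - U \<longrightarrow> u x \<ge> reflect_fun k u x) \<and>
     in_Wsp0_dual s p U (\<lambda>x. V x * (u x - reflect_fun k u x)) \<and>
     (\<forall>\<phi> \<in> Wsp0 s p U. (AE x in lebesgue. \<phi> x \<ge> 0) \<longrightarrow>
        frac_p_laplacian s p u \<phi> - frac_p_laplacian s p (reflect_fun k u) \<phi>
          \<ge> (LINT x:U|lebesgue. V x * (u x - reflect_fun k u x) * \<phi> x))"

end

theory Submission
  imports Defs
begin

text \<open>
  Write \<open>g t = |t| powr (p - 2) * t\<close>, \<open>w = u - u*\<close>, and let \<open>\<phi>\<close> be the negative part of \<open>w\<close> on \<open>U\<close>, extended
  by zero. The function \<open>\<phi>\<close> is an admissible test function: inside the half space it is the negative part of \<open>w\<close> almost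
  everywhere, and across the hyperplane the antisymmetry of \<open>w\<close> controls it (\<open>\<phi>_Wsp0\<close>).

  Tested with \<open>\<phi>\<close>, the operator side is the integral over pairs \<open>(x, y)\<close> of
  \<open>(g (u x - u y) - g (u* x - u* y)) (\<phi> x - \<phi> y) K (x - y)\<close>, with \<open>K\<close> the kernel. Averaging over the
  four pairs \<open>(x, y)\<close>, \<open>(x*, y)\<close>, \<open>(x, y*)\<close>, \<open>(x*, y*)\<close> does not change the integral and makes the integrand
  nonpositive. The reason is that \<open>g\<close> is increasing and that, for \<open>x, y\<close> in the half space, \<open>K (x - y*) \<le> K (x - y)\<close>
  (\<open>paired_energy_density_nonpos\<close>). Since \<open>p < 2\<close> and \<open>|u| \<le> M\<close>, the slope of \<open>g\<close> on the
  relevant range is at least \<open>c = (p - 1) (2 M) powr (p - 2)\<close>. So if \<open>x\<close> is in \<open>U\<close> and \<open>y\<close> is in the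
  half space outside \<open>U\<close>, the sum over the four pairs is even at most \<open>- c (\<phi> x)^2 K (x - y)\<close>
  (\<open>paired_energy_density_coercive\<close>). This bound is quadratic in \<open>\<phi>\<close> although the operator has growth \<open>p - 1\<close>,
  and that is where the factor \<open>M powr (2 - p)\<close> comes from.

  It remains to integrate over \<open>y\<close>. Among the points of the half space at distance of order \<open>|U| powr (1 / N)\<close> from \<open>x\<close>,
  a set of measure at least \<open>|U|\<close> lies outside \<open>U\<close>, so the integral of \<open>K (x - y)\<close> over these \<open>y\<close> is at least a constant
  times \<open>|U| powr - (s p / N)\<close> (\<open>half_space_kernel_lower_bound\<close>). The right-hand side of the inequality
  is at least minus the norm of \<open>V+\<close> times the integral of \<open>\<phi>^2\<close>, because \<open>w \<phi> = - \<phi>^2\<close> on \<open>U\<close>. Under the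
  smallness condition the two bounds are compatible only if \<open>\<phi>\<close> vanishes almost everywhere.
\<close>

section \<open>Monotonicity of the signed power\<close>

definition signed_power :: "real \<Rightarrow> real \<Rightarrow> real" where
  "signed_power p t = \<bar>t\<bar> powr (p - 2) * t"

lemma J_eq_signed_power: "J p u x y = signed_power p (u x - u y)"
  by (simp add: J_def signed_power_def)

lemma signed_power_minus: "signed_power p (- t) = - signed_power p t"
  by (simp add: signed_power_def)

lemma signed_power_nonneg: "t \<ge> 0 \<Longrightarrow> signed_power p t = t powr (p - 1)"
  by (cases "t = 0") (auto simp: signed_power_def powr_diff power2_eq_square powr_numeral field_simps)

lemma abs_signed_power: "\<bar>signed_power p t\<bar> = \<bar>t\<bar> powr (p - 1)"
proof -
  have "\<bar>signed_power p t\<bar> = signed_power p \<bar>t\<bar>"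
    by (simp add: signed_power_def abs_mult)
  then show ?thesis by (simp add: signed_power_nonneg)
qed

text \<open>The derivative \<open>(p - 1) z powr (p - 2)\<close> decreases in \<open>z\<close> because \<open>p < 2\<close>, so on \<open>[0, R]\<close> it is
  smallest at \<open>R\<close>. Boundedness of the arguments therefore turns the strict monotonicity of
  the signed power into a linear lower bound.\<close>

lemma signed_power_increment_nonneg:
  assumes p: "1 < p" "p < 2" and st: "0 \<le> s" "s \<le> t" "t \<le> R"
  shows "(p - 1) * R powr (p - 2) * (t - s) \<le> signed_power p t - signed_power p s"
proof (cases "s = t")
  case False
  then have lt: "s < t" using st by simp
  have cont: "continuous_on {s..t} (\<lambda>z. z powr (p - 1))"
    using p st by (intro continuous_on_powr') auto
  have der: "((\<lambda>z. z powr (p - 1)) has_derivative (\<lambda>h. h * ((p - 1) * z powr (p - 2)))) (at z)"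
    if "s < z" "z < t" for z
  proof -
    have "((\<lambda>z. z powr (p - 1)) has_real_derivative (p - 1) * z powr (p - 1 - 1)) (at z)"
      using that st by (intro has_real_derivative_powr) auto
    then show ?thesis by (simp add: has_field_derivative_def mult_commute_abs)
  qed
  obtain z where z: "s < z" "z < t"
    "t powr (p - 1) - s powr (p - 1) = (t - s) * ((p - 1) * z powr (p - 2))"
    using mvt[OF lt cont der] by auto
  have "R powr (p - 2) \<le> z powr (p - 2)"
    using z st p by (intro powr_mono2') auto
  then have "(p - 1) * R powr (p - 2) * (t - s) \<le> (p - 1) * z powr (p - 2) * (t - s)"
    using p lt by (intro mult_right_mono mult_left_mono) auto
  then show ?thesis using z st lt by (simp add: signed_power_nonneg mult_ac)
qed simp

lemma signed_power_increment:
  assumes p: "1 < p" "p < 2" and st: "\<bar>s\<bar> \<le> R" "s \<le> t" "\<bar>t\<bar> \<le> R"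
  shows "(p - 1) * R powr (p - 2) * (t - s) \<le> signed_power p t - signed_power p s"
proof -
  consider "0 \<le> s" | "t \<le> 0" | "s < 0" "0 < t" by linarith
  then show ?thesis
  proof cases
    case 1
    then show ?thesis using signed_power_increment_nonneg[OF p, of s t R] st by simp
  next
    case 2
    then show ?thesis using signed_power_increment_nonneg[OF p, of "- t" "- s" R] st
      by (simp add: signed_power_minus)
  next
    case 3
    then show ?thesis
      using signed_power_increment_nonneg[OF p, of 0 "- s" R]
        signed_power_increment_nonneg[OF p, of 0 t R] st
      by (simp add: signed_power_minus signed_power_def algebra_simps)
  qed
qed

lemma signed_power_mono:
  assumes "1 < p" "p < 2" "s \<le> t"
  shows "signed_power p s \<le> signed_power p t"
proof -
  have "0 \<le> (p - 1) * (max \<bar>s\<bar> \<bar>t\<bar>) powr (p - 2) * (t - s)" using assms by simp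
  with signed_power_increment[of p s "max \<bar>s\<bar> \<bar>t\<bar>" t] assms show ?thesis by linarith
qed

section \<open>The pointwise estimate for reflected pairs\<close>

text \<open>The core of the argument. Here \<open>a, a', b, b'\<close> stand for the values of \<open>u\<close> at \<open>x\<close>, \<open>x*\<close>, \<open>y\<close>, \<open>y*\<close>,
  and \<open>k\<close>, \<open>k'\<close> for the kernel at \<open>x - y\<close> and \<open>x - y*\<close>. The first bracket is at most
  \<open>- c \<phi>\<close> for \<open>c = (p - 1) (2 M) powr (p - 2)\<close>. The second can have either sign; when it is
  positive, its weight \<open>k'\<close> may be raised to \<open>k\<close>, and in the sum of the two brackets the terms regroup as
  increments of the signed power between \<open>a\<close> and \<open>a'\<close>, each of the good sign.\<close>

lemma paired_energy_density_coercive: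
  fixes a a' b b' :: real
  assumes p: "1 < p" "p < 2"
    and bd: "\<bar>a\<bar> \<le> M" "\<bar>a'\<bar> \<le> M" "\<bar>b\<bar> \<le> M" "\<bar>b'\<bar> \<le> M"
    and k: "0 \<le> k'" "k' \<le> k" and b: "b' \<le> b"
  defines "\<phi> \<equiv> max (a' - a) 0"
  shows "(signed_power p (a - b) - signed_power p (a' - b')) * \<phi> * k
      + (signed_power p (a - b') - signed_power p (a' - b)) * \<phi> * k'
      \<le> - ((p - 1) * (2 * M) powr (p - 2) * \<phi>\<^sup>2 * k)"
proof (cases "a < a'")
  case False
  then show ?thesis by (simp add: \<phi>_def)
next
  case True
  define c where "c = (p - 1) * (2 * M) powr (p - 2)"
  have c: "0 \<le> c" using p by (simp add: c_def)
  have \<phi>: "\<phi> = a' - a" "0 < \<phi>" using True by (auto simp: \<phi>_def)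
  define S where "S = signed_power p (a - b) - signed_power p (a' - b')"
  define T where "T = signed_power p (a - b') - signed_power p (a' - b)"
  have S: "S \<le> - (c * \<phi>)"
  proof -
    have "c * ((a' - b') - (a - b)) \<le> - S"
      using signed_power_increment[OF p, of "a - b" "2 * M" "a' - b'"] bd b True
      unfolding S_def c_def by auto
    moreover have "c * \<phi> \<le> c * ((a' - b') - (a - b))"
      using c b \<phi> by (intro mult_left_mono) auto
    ultimately show ?thesis by linarith
  qed
  \<comment> \<open>Regroup \<open>S + T\<close> into \<open>(g (a - b) - g (a' - b)) + (g (a - b') - g (a' - b'))\<close>.\<close>
  have ST: "S + T \<le> - (c * \<phi>)"
  proof -
    have 1: "c * \<phi> \<le> signed_power p (a' - b) - signed_power p (a - b)"
      using signed_power_increment[OF p, of "a - b" "2 * M" "a' - b"] bd True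
      unfolding c_def \<phi> by auto
    have 2: "signed_power p (a - b') \<le> signed_power p (a' - b')"
      using p True by (intro signed_power_mono) auto
    show ?thesis using 1 2 unfolding S_def T_def by linarith
  qed
  have "S * k + T * k' \<le> - (c * \<phi>) * k"
  proof (cases "T \<le> 0")
    case True
    then have "T * k' \<le> 0" using k by (simp add: mult_nonpos_nonneg)
    moreover have "S * k \<le> - (c * \<phi>) * k" using S k by (intro mult_right_mono) auto
    ultimately show ?thesis by linarith
  next
    case False
    then have "T * k' \<le> T * k" using k by (intro mult_left_mono) auto
    moreover have "(S + T) * k \<le> - (c * \<phi>) * k" using ST k by (intro mult_right_mono) auto
    ultimately show ?thesis by (simp add: algebra_simps)
  qed
  then have "(S * k + T * k') * \<phi> \<le> - (c * \<phi>) * k * \<phi>"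
    using \<phi> by (intro mult_right_mono) auto
  then show ?thesis unfolding S_def[symmetric] T_def[symmetric] c_def[symmetric]
    by (simp add: algebra_simps power2_eq_square)
qed

text \<open>If \<open>a < a'\<close> and \<open>b < b'\<close>, then both terms are nonpositive by monotonicity alone; if only one of the two
  strict inequalities holds, the coercive estimate applies after exchanging the roles of \<open>x\<close> and \<open>y\<close> if necessary.
  The disjunction in the hypothesis covers the diagonal \<open>x = y\<close>, where the kernel takes the
  default value \<open>0\<close> and \<open>k' \<le> k\<close> fails.\<close>

lemma paired_energy_density_nonpos:
  fixes a a' b b' :: real
  assumes p: "1 < p" "p < 2"
    and k: "0 \<le> k'" "k' \<le> k \<or> (a = b \<and> a' = b')"
  defines "\<phi> \<equiv> max (a' - a) 0" and "\<psi> \<equiv> max (b' - b) 0"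
  shows "(signed_power p (a - b) - signed_power p (a' - b')) * (\<phi> - \<psi>) * k
      + (signed_power p (a - b') - signed_power p (a' - b)) * (\<phi> + \<psi>) * k' \<le> 0"
proof -
  \<comment> \<open>Some bound on the four numbers is needed to invoke the coercive estimate; its size only affects a term that is dropped.\<close>
  define M where "M = \<bar>a\<bar> + \<bar>a'\<bar> + \<bar>b\<bar> + \<bar>b'\<bar>"
  have M: "\<bar>a\<bar> \<le> M" "\<bar>a'\<bar> \<le> M" "\<bar>b\<bar> \<le> M" "\<bar>b'\<bar> \<le> M" by (auto simp: M_def)
  have nn: "0 \<le> (p - 1) * (2 * M) powr (p - 2) * q\<^sup>2 * k" if "k' \<le> k" for q
    using p k that by simp
  consider "a < a'" "b < b'" | "a' \<le> a" "b' \<le> b" | "b' \<le> b" "k' \<le> k" | "a' \<le> a" "k' \<le> k"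
    using k by linarith
  then show ?thesis
  proof cases
    case 1
    have T: "signed_power p (a - b') \<le> signed_power p (a' - b)"
      using 1 p by (intro signed_power_mono) auto
    have "(signed_power p (a - b') - signed_power p (a' - b)) * (\<phi> + \<psi>) * k' \<le> 0"
      using T k by (intro mult_nonpos_nonneg) (auto simp: \<phi>_def \<psi>_def mult_nonpos_nonneg)
    moreover have "(signed_power p (a - b) - signed_power p (a' - b')) * (\<phi> - \<psi>) * k \<le> 0"
    proof (cases "a = b \<and> a' = b'")
      case False
      then have k0: "0 \<le> k" using k by linarith
      have "(signed_power p (a - b) - signed_power p (a' - b')) * (\<phi> - \<psi>) \<le> 0"
      proof (cases "a - b \<le> a' - b'")
        case True
        then show ?thesis using signed_power_mono[OF p True] 1
          by (intro mult_nonpos_nonneg) (auto simp: \<phi>_def \<psi>_def)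
      next
        case False
        then show ?thesis using signed_power_mono[OF p, of "a' - b'" "a - b"] 1
          by (intro mult_nonneg_nonpos) (auto simp: \<phi>_def \<psi>_def)
      qed
      then show ?thesis using k0 by (rule mult_nonpos_nonneg)
    qed auto
    ultimately show ?thesis by linarith
  next
    case 2
    then show ?thesis by (simp add: \<phi>_def \<psi>_def)
  next
    case 3
    then have "\<psi> = 0" by (simp add: \<psi>_def)
    then show ?thesis
      using paired_energy_density_coercive[OF p M k(1) 3(2) 3(1)] nn[OF 3(2), of \<phi>]
      unfolding \<phi>_def by simp
  next
    case 4
    have flip: "signed_power p (x - y) = - signed_power p (y - x)" for x y
      using signed_power_minus[of p "y - x"] by simp
    have \<phi>0: "\<phi> = 0" using 4 by (simp add: \<phi>_def)
    have "(signed_power p (b - a) - signed_power p (b' - a')) * \<psi> * k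
      + (signed_power p (b - a') - signed_power p (b' - a)) * \<psi> * k' \<le> 0"
      using paired_energy_density_coercive[OF p M(3,4,1,2) k(1) 4(2) 4(1)] nn[OF 4(2), of \<psi>]
      unfolding \<psi>_def by simp
    then show ?thesis
      unfolding \<phi>0 flip[of b a] flip[of b' a'] flip[of b a'] flip[of b' a]
      by (simp add: algebra_simps)
  qed
qed

section \<open>Lebesgue measure on pairs of points\<close>

lemma sigma_finite_lebesgue: "sigma_finite_measure (lebesgue :: 'a::euclidean_space measure)"
proof
  obtain A :: "'a set set" where A: "countable A \<and> A \<subseteq> sets lborel \<and> \<Union>A = space lborel \<and>
      (\<forall>a\<in>A. emeasure lborel a \<noteq> \<infinity>)"
    using lborel.sigma_finite_countable ..
  have "a \<in> sets lebesgue \<and> emeasure lebesgue a \<noteq> \<infinity>" if "a \<in> A" for a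
  proof -
    have "a \<in> sets lborel" "emeasure lborel a \<noteq> \<infinity>" using A that by blast+
    then show ?thesis by simp
  qed
  then show "\<exists>A::'a set set. countable A \<and> A \<subseteq> sets lebesgue \<and> \<Union>A = space lebesgue \<and>
      (\<forall>a\<in>A. emeasure lebesgue a \<noteq> \<infinity>)"
    using A by (intro exI[of _ A]) (simp only: space_completion, blast)
qed

interpretation lebesgue: sigma_finite_measure "lebesgue :: 'a::euclidean_space measure"
  by (rule sigma_finite_lebesgue)

interpretation lebesgue_pair: pair_sigma_finite
  "lebesgue :: 'a::euclidean_space measure" "lebesgue :: 'b::euclidean_space measure" ..

abbreviation lebesgue2 :: "('a::euclidean_space \<times> 'b::euclidean_space) measure" where
  "lebesgue2 \<equiv> lebesgue \<Otimes>\<^sub>M lebesgue"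

lemma AE_lebesgue_pair_fst:
  assumes "AE x in (lebesgue :: 'a::euclidean_space measure). P x"
  shows "AE q in (lebesgue :: 'a measure) \<Otimes>\<^sub>M (lebesgue :: 'b::euclidean_space measure). P (fst q)"
proof -
  obtain N where N: "{x. \<not> P x} \<subseteq> N" "N \<in> null_sets lebesgue"
    using assms by (auto simp: eventually_ae_filter)
  then have "N \<times> (UNIV :: 'b set) \<in> null_sets (lebesgue \<Otimes>\<^sub>M lebesgue)"
    by (auto simp: null_sets_def lebesgue.emeasure_pair_measure_Times)
  then show ?thesis by (rule AE_I') (use N in auto)
qed

lemma AE_lebesgue_pair_snd:
  assumes "AE x in (lebesgue :: 'b::euclidean_space measure). P x"
  shows "AE q in (lebesgue :: 'a::euclidean_space measure) \<Otimes>\<^sub>M (lebesgue :: 'b measure). P (snd q)"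
proof -
  obtain N where N: "{x. \<not> P x} \<subseteq> N" "N \<in> null_sets lebesgue"
    using assms by (auto simp: eventually_ae_filter)
  then have "(UNIV :: 'a set) \<times> N \<in> null_sets (lebesgue \<Otimes>\<^sub>M lebesgue)"
    by (auto simp: null_sets_def lebesgue.emeasure_pair_measure_Times)
  then show ?thesis by (rule AE_I') (use N in auto)
qed

lemma measurable_lebesgue_ident [measurable]: "(\<lambda>x. x) \<in> lebesgue \<rightarrow>\<^sub>M borel"
  by (simp add: measurable_completion)

section \<open>Reflection in a coordinate hyperplane\<close>

lemma reflect_reflect [simp]: "reflect k (reflect k x) = x"
  by (simp add: reflect_def vec_eq_iff)

lemma reflect_nth: "reflect k x $ i = (if i = k then - (x $ i) else x $ i)"
  by (simp add: reflect_def)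

lemma reflect_diff: "reflect k x - reflect k y = reflect k (x - y)"
  by (simp add: reflect_def vec_eq_iff)

lemma norm_reflect [simp]: "norm (reflect k x) = norm x"
  unfolding norm_vec_def L2_set_def
  by (intro arg_cong[where f=sqrt] sum.cong) (auto simp: reflect_nth)

lemma norm_reflect_diff: "norm (reflect k x - y) = norm (x - reflect k y)"
  using reflect_diff[of k x "reflect k y"] norm_reflect[of k "x - reflect k y"] by simp

lemma norm_reflect_diff_reflect: "norm (reflect k x - reflect k y) = norm (x - y)"
  by (simp add: reflect_diff)

text \<open>Two points on the same side of the hyperplane are closer to each other than to each other's
  mirror images; this is why the kernel at \<open>x - y\<close> dominates the one at \<open>x - y*\<close>.\<close>

lemma norm_diff_le_norm_diff_reflect:
  assumes "0 < x $ k" "0 < y $ k"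
  shows "norm (x - y) \<le> norm (x - reflect k y)"
  unfolding norm_vec_def
proof (rule L2_set_mono)
  fix i :: 'a
  show "norm ((x - y) $ i) \<le> norm ((x - reflect k y) $ i)"
    using assms by (auto simp: reflect_nth)
qed simp

lemma reflect_image_iff: "x \<in> reflect k ` U \<longleftrightarrow> reflect k x \<in> U"
  by (auto simp: image_iff intro!: bexI[of _ "reflect k x"])

text \<open>This is the coordinatewise scaling form for which the transformation behaviour of Lebesgue measure is known.\<close>

lemma reflect_affine:
  "reflect (k :: 'n::finite) = (\<lambda>x. 0 + (\<Sum>j\<in>Basis. ((if j = axis k 1 then - 1 else 1) * (x \<bullet> j)) *\<^sub>R j))"
    (is "_ = (\<lambda>x. 0 + sum (?f x) _)")
proof
  fix x :: "real ^ 'n"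
  have "reflect k x \<bullet> j = (0 + sum (?f x) Basis) \<bullet> j" if j: "j \<in> Basis" for j
  proof -
    obtain i where i: "j = axis i 1" using j by (auto simp: Basis_vec_def)
    have "sum (?f x) Basis \<bullet> j = (if j = axis k 1 then - 1 else 1) * (x \<bullet> j)"
      using j by (simp add: inner_sum_left inner_Basis if_distrib sum.delta cong: if_cong)
    then show ?thesis using i by (auto simp: inner_axis reflect_nth axis_eq_axis)
  qed
  then show "reflect k x = 0 + sum (?f x) Basis" by (rule euclidean_eqI)
qed

lemma measurable_reflect [measurable]: "reflect k \<in> lebesgue \<rightarrow>\<^sub>M lebesgue"
  by (subst reflect_affine, rule lebesgue_affine_measurable) auto

lemma distr_lebesgue_reflect: "distr lebesgue lebesgue (reflect (k :: 'n::finite)) = lebesgue"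
proof -
  have "prod (\<lambda>j. \<bar>(if j = axis k 1 then - 1 else 1) :: real\<bar>) (Basis :: (real ^ 'n) set) = 1"
    by (rule prod.neutral) auto
  moreover have "density (distr lebesgue lebesgue (reflect k))
      (\<lambda>_. ennreal (prod (\<lambda>j. \<bar>(if j = axis k 1 then - 1 else 1) :: real\<bar>) (Basis :: (real ^ 'n) set)))
      = lebesgue"
    unfolding reflect_affine by (rule lebesgue_affine_euclidean[symmetric]) auto
  ultimately show ?thesis by (simp only: ennreal_1 density_1)
qed

lemma AE_reflect:
  assumes "AE x in lebesgue. P x"
  shows "AE x in lebesgue. P (reflect k x)"
proof (rule AE_distrD[OF measurable_reflect])
  show "AE x in distr lebesgue lebesgue (reflect k). P x"
    unfolding distr_lebesgue_reflect by (rule assms)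
qed

lemma distr_pair_reflect_fst:
  "distr (lebesgue \<Otimes>\<^sub>M lebesgue) (lebesgue \<Otimes>\<^sub>M lebesgue) (\<lambda>(x, y). (reflect k x, y)) = lebesgue \<Otimes>\<^sub>M lebesgue"
  using pair_measure_distr[of "reflect k" lebesgue lebesgue "\<lambda>y. y" lebesgue lebesgue, symmetric]
  by (simp add: distr_lebesgue_reflect lebesgue.sigma_finite_measure_axioms)

lemma distr_pair_reflect_snd:
  "distr (lebesgue \<Otimes>\<^sub>M lebesgue) (lebesgue \<Otimes>\<^sub>M lebesgue) (\<lambda>(x, y). (x, reflect k y)) = lebesgue \<Otimes>\<^sub>M lebesgue"
  using pair_measure_distr[of "\<lambda>y. y" lebesgue lebesgue "reflect k" lebesgue lebesgue, symmetric]
  by (simp add: distr_lebesgue_reflect lebesgue.sigma_finite_measure_axioms)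

lemma integrable_reflect_fst:
  fixes f :: "(real ^ 'n::finite) \<times> 'b::euclidean_space \<Rightarrow> real"
  assumes "integrable lebesgue2 f"
  shows "integrable lebesgue2 (\<lambda>(x, y). f (reflect k x, y))"
    and "(LINT (x, y)|lebesgue2. f (reflect k x, y)) = integral\<^sup>L lebesgue2 f"
proof -
  have f: "f \<in> borel_measurable lebesgue2" using assms by auto
  have T: "(\<lambda>(x, y). (reflect k x, y)) \<in> (lebesgue2 :: ((real ^ 'n) \<times> 'b) measure) \<rightarrow>\<^sub>M lebesgue2" by measurable
  show "integrable lebesgue2 (\<lambda>(x, y). f (reflect k x, y))"
    using integrable_distr_eq[OF T f] assms unfolding distr_pair_reflect_fst by (simp add: case_prod_unfold)
  show "(LINT (x, y)|lebesgue2. f (reflect k x, y)) = integral\<^sup>L lebesgue2 f"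
    using integral_distr[OF T f] unfolding distr_pair_reflect_fst by (simp add: case_prod_unfold)
qed

lemma integrable_reflect_snd:
  fixes f :: "'b::euclidean_space \<times> (real ^ 'n::finite) \<Rightarrow> real"
  assumes "integrable lebesgue2 f"
  shows "integrable lebesgue2 (\<lambda>(x, y). f (x, reflect k y))"
    and "(LINT (x, y)|lebesgue2. f (x, reflect k y)) = integral\<^sup>L lebesgue2 f"
proof -
  have f: "f \<in> borel_measurable lebesgue2" using assms by auto
  have T: "(\<lambda>(x, y). (x, reflect k y)) \<in> (lebesgue2 :: ('b \<times> (real ^ 'n)) measure) \<rightarrow>\<^sub>M lebesgue2" by measurable
  show "integrable lebesgue2 (\<lambda>(x, y). f (x, reflect k y))"
    using integrable_distr_eq[OF T f] assms unfolding distr_pair_reflect_snd by (simp add: case_prod_unfold)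
  show "(LINT (x, y)|lebesgue2. f (x, reflect k y)) = integral\<^sup>L lebesgue2 f"
    using integral_distr[OF T f] unfolding distr_pair_reflect_snd by (simp add: case_prod_unfold)
qed

section \<open>The kernel and its mass outside a set of finite measure\<close>

definition kernel :: "real \<Rightarrow> (real ^ 'n::finite) \<Rightarrow> real" where
  "kernel \<alpha> z = 1 / norm z powr \<alpha>"

lemma kernel_nonneg: "0 \<le> kernel \<alpha> z"
  by (simp add: kernel_def)

lemma kernel_minus_commute: "kernel \<alpha> (x - y) = kernel \<alpha> (y - x)"
  by (simp add: kernel_def norm_minus_commute)

lemma kernel_mono:
  assumes "z \<noteq> 0" "norm z \<le> norm z'" "0 \<le> \<alpha>"
  shows "kernel \<alpha> z' \<le> kernel \<alpha> z"
proof -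
  have "z' \<noteq> 0" using assms(1,2) by auto
  then show ?thesis
    unfolding kernel_def using assms by (intro divide_left_mono powr_mono2) auto
qed

lemma kernel_measurable [measurable]: "kernel \<alpha> \<in> borel_measurable borel"
  unfolding kernel_def by measurable

text \<open>The ball of radius \<open>r = root N (2 m / \<omega>)\<close>, with \<open>\<omega>\<close> the volume of the unit ball, has volume \<open>2 m\<close>. The constant is
  \<open>(2 r) powr - (N + \<sigma>)\<close> for \<open>m = 1\<close>: a lower bound for the kernel on distances up to \<open>2 r\<close>.\<close>

definition ball_constant :: "nat \<Rightarrow> real \<Rightarrow> real" where
  "ball_constant N \<sigma> = (2 * root N (2 / unit_ball_vol (real N))) powr - (real N + \<sigma>)"

lemma ball_constant_pos:
  assumes "0 < N"
  shows "0 < ball_constant N \<sigma>"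
proof -
  have "0 < 2 / unit_ball_vol (real N)" by (intro divide_pos_pos unit_ball_vol_pos) auto
  then have "0 < root N (2 / unit_ball_vol (real N))" using assms by (rule real_root_gt_zero[rotated])
  then show ?thesis by (simp add: ball_constant_def)
qed

text \<open>The replacement for a fractional Poincare inequality. A ball of volume \<open>2 |U|\<close> touching \<open>x\<close> from above, in direction \<open>k\<close>, lies in
  the half space and leaves at least \<open>|U|\<close> of volume outside \<open>U\<close>. All of it is within one diameter of \<open>x\<close>,
  a length proportional to \<open>|U| powr (1 / N)\<close>, and this gives the power \<open>- \<sigma> / N\<close> of \<open>|U|\<close>.\<close>

lemma half_space_kernel_lower_bound:
  fixes x :: "real ^ 'n::finite"
  assumes U: "U \<in> lmeasurable" "0 < measure lebesgue U" and x: "0 < x $ k" and \<sigma>: "0 < \<sigma>"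
  shows "ennreal (ball_constant CARD('n) \<sigma> * measure lebesgue U powr - (\<sigma> / real CARD('n)))
    \<le> (\<integral>\<^sup>+y\<in>half_space k - U. ennreal (kernel (real CARD('n) + \<sigma>) (x - y)) \<partial>lebesgue)"
proof -
  define N where "N = CARD('n)"
  define m where "m = measure lebesgue U"
  define q where "q = root N (2 / unit_ball_vol (real N))"
  define r where "r = q * root N m"
  have N: "0 < N" by (simp add: N_def)
  have m: "0 < m" using U by (simp add: m_def)
  have vol: "0 < unit_ball_vol (real N)" "unit_ball_vol (real N) \<noteq> 0"
    using unit_ball_vol_pos[of "real N"] by linarith+
  have q: "0 < q" using vol N by (simp add: q_def)
  have r: "0 < r" using q m N by (simp add: r_def)
  define B where "B = ball (x + r *\<^sub>R axis k 1) r"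
  have measB: "measure lebesgue B = 2 * m"
    using r N m vol unfolding B_def
    by (simp add: content_ball r_def q_def power_mult_distrib N_def[symmetric] real_root_pow_pos2)
  have B: "B \<in> lmeasurable" by (simp add: B_def)
  have near: "norm (x - y) \<le> 2 * r" if "y \<in> B" for y
  proof -
    have "norm (x - y) \<le> norm (x + r *\<^sub>R axis k 1 - y) + norm (r *\<^sub>R axis k (1::real))"
      using norm_triangle_ineq4[of "x + r *\<^sub>R axis k 1 - y" "r *\<^sub>R axis k 1"] by (simp add: algebra_simps)
    then show ?thesis using that r by (simp add: B_def dist_norm)
  qed
  have up: "y \<in> half_space k" if "y \<in> B" for y
  proof -
    have "\<bar>(x + r *\<^sub>R axis k 1 - y) $ k\<bar> < r"
      using component_le_norm_cart[of "x + r *\<^sub>R axis k 1 - y" k] that by (simp add: B_def dist_norm)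
    then show ?thesis using x by (simp add: half_space_def)
  qed
  have mBU: "m \<le> measure lebesgue (B - U)"
  proof -
    have "measure lebesgue B \<le> measure lebesgue (B - U) + measure lebesgue U"
      using measure_Un_le[of "B - U" lebesgue U] B U
        measure_mono_fmeasurable[of B "B \<union> U" lebesgue] fmeasurable.Un[OF B U(1)]
      by (auto simp: fmeasurableD)
    then show ?thesis using measB by (simp add: m_def)
  qed
  define c where "c = (2 * r) powr - (real N + \<sigma>)"
  have pt: "c \<le> kernel (real N + \<sigma>) (x - y)" if "y \<in> B" "y \<noteq> x" for y
    using near[OF that(1)] that \<sigma> unfolding c_def kernel_def powr_minus_divide[symmetric]
    by (intro powr_mono2') auto
  have xB: "x \<notin> B" using r by (simp add: B_def dist_norm)
  have "ball_constant N \<sigma> * m powr - (\<sigma> / real N) = c * m"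
  proof -
    have "root N m powr - (real N + \<sigma>) = m powr (- 1 - \<sigma> / real N)"
      using N m by (simp add: root_powr_inverse powr_powr add_divide_distrib diff_divide_distrib)
    also have "\<dots> = m powr - (\<sigma> / real N) / m"
      using powr_diff[of m "- (\<sigma> / real N)" 1] m by (simp add: minus_diff_commute)
    finally have "root N m powr - (real N + \<sigma>) * m = m powr - (\<sigma> / real N)" using m by simp
    moreover have "c = (2 * q) powr - (real N + \<sigma>) * root N m powr - (real N + \<sigma>)"
      unfolding c_def r_def using q m by (subst powr_mult[symmetric]) (auto simp: mult_ac)
    ultimately show ?thesis by (simp add: ball_constant_def q_def mult.assoc)
  qed
  also have "ennreal (c * m) \<le> ennreal (c * measure lebesgue (B - U))"
    using mBU by (intro ennreal_leI mult_left_mono) (auto simp: c_def)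
  also have "\<dots> = (\<integral>\<^sup>+y. ennreal c * indicator (B - U) y \<partial>lebesgue)"
    using B U by (subst nn_integral_cmult_indicator)
      (auto simp: c_def ennreal_mult emeasure_eq_measure2 fmeasurable.Diff fmeasurableD)
  also have "\<dots> \<le> (\<integral>\<^sup>+y\<in>half_space k - U. ennreal (kernel (real N + \<sigma>) (x - y)) \<partial>lebesgue)"
    using up pt xB by (intro nn_integral_mono) (auto simp: indicator_def intro!: ennreal_leI)
  finally show ?thesis unfolding N_def m_def .
qed

section \<open>Energies and the fractional p-Laplacian as integrals over pairs\<close>

definition energy_density ::
    "real \<Rightarrow> real \<Rightarrow> (real ^ 'n::finite) set \<Rightarrow> (real ^ 'n \<Rightarrow> real) \<Rightarrow> (real ^ 'n) \<times> (real ^ 'n) \<Rightarrow> real" where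
  "energy_density s p A w =
     (\<lambda>(x, y). indicator A x * (\<bar>w x - w y\<bar> powr p * kernel (real CARD('n) + s * p) (x - y)))"

lemma energy_density_nonneg: "0 \<le> energy_density s p A w q"
  by (simp add: energy_density_def kernel_nonneg case_prod_unfold)

lemma energy_density_measurable:
  assumes "w \<in> borel_measurable lebesgue" "A \<in> sets lebesgue"
  shows "energy_density s p A w \<in> borel_measurable lebesgue2"
  using assms unfolding energy_density_def by measurable

text \<open>On the product space, reflections and the exchange of \<open>x\<close> and \<open>y\<close> are measure-preserving maps, and finiteness of an
  energy can be checked by dominating its density. This is why energies are handled there and not as iterated integrals.\<close>

lemma gagliardo_integral_finite_iff:
  assumes [measurable]: "w \<in> borel_measurable lebesgue" "A \<in> sets lebesgue"
  shows "gagliardo_integral s p A w < \<infinity> \<longleftrightarrow> integrable lebesgue2 (energy_density s p A w)"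
proof -
  note meas [measurable] = energy_density_measurable[OF assms]
  have "gagliardo_integral s p A w = (\<integral>\<^sup>+x. \<integral>\<^sup>+y. ennreal (energy_density s p A w (x, y)) \<partial>lebesgue \<partial>lebesgue)"
    unfolding gagliardo_integral_def energy_density_def kernel_def
    by (intro nn_integral_cong) (auto split: split_indicator)
  also have "\<dots> = (\<integral>\<^sup>+q. ennreal (energy_density s p A w q) \<partial>lebesgue2)"
    by (rule lebesgue.nn_integral_fst) measurable
  finally show ?thesis
    by (simp add: integrable_iff_bounded energy_density_nonneg meas)
qed

lemma powr_add_le_powr_mult_add:
  fixes a b p :: real
  assumes "0 \<le> a" "0 \<le> b" "0 \<le> p"
  shows "(a + b) powr p \<le> 2 powr p * (a powr p + b powr p)"
proof -
  have "(a + b) powr p \<le> (2 * max a b) powr p" using assms by (intro powr_mono2) auto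
  also have "\<dots> = 2 powr p * max a b powr p" using assms by (subst powr_mult) auto
  also have "\<dots> \<le> 2 powr p * (a powr p + b powr p)"
    by (intro mult_left_mono) (auto simp: max_def)
  finally show ?thesis .
qed

lemma energy_density_diff_le:
  assumes "0 \<le> p"
  shows "energy_density s p A (\<lambda>x. u x - v x) q
    \<le> 2 powr p * (energy_density s p A u q + energy_density s p A v q)"
proof -
  obtain x y where q: "q = (x, y)" by fastforce
  have "\<bar>(u x - v x) - (u y - v y)\<bar> powr p \<le> (\<bar>u x - u y\<bar> + \<bar>v x - v y\<bar>) powr p"
    using assms by (intro powr_mono2) auto
  also have "\<dots> \<le> 2 powr p * (\<bar>u x - u y\<bar> powr p + \<bar>v x - v y\<bar> powr p)"
    using assms by (intro powr_add_le_powr_mult_add) auto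
  finally have "indicator A x * kernel (real CARD('a) + s * p) (x - y) * \<bar>(u x - v x) - (u y - v y)\<bar> powr p
      \<le> indicator A x * kernel (real CARD('a) + s * p) (x - y) * (2 powr p * (\<bar>u x - u y\<bar> powr p + \<bar>v x - v y\<bar> powr p))"
    by (intro mult_left_mono) (auto simp: kernel_nonneg)
  then show ?thesis by (simp add: q energy_density_def algebra_simps)
qed

lemma integrable_energy_density_reflect:
  assumes "integrable lebesgue2 (energy_density s p (reflect k ` A) u)"
  shows "integrable lebesgue2 (energy_density s p A (reflect_fun k u))"
proof -
  have eq: "(\<lambda>(x, y). (\<lambda>(x, y). energy_density s p (reflect k ` A) u (reflect k x, y)) (x, reflect k y))
    = energy_density s p A (reflect_fun k u)"
    by (auto simp: fun_eq_iff energy_density_def reflect_fun_def kernel_def norm_reflect_diff_reflect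
        reflect_image_iff indicator_def)
  show ?thesis
    using integrable_reflect_snd(1)[OF integrable_reflect_fst(1)[OF assms, of k], of k]
    unfolding eq .
qed

lemma integrable_energy_density_diff:
  assumes "0 \<le> p" and [measurable]: "u \<in> borel_measurable lebesgue" "v \<in> borel_measurable lebesgue" "A \<in> sets lebesgue"
    and "integrable lebesgue2 (energy_density s p A u)" "integrable lebesgue2 (energy_density s p A v)"
  shows "integrable lebesgue2 (energy_density s p A (\<lambda>x. u x - v x))"
proof (rule Bochner_Integration.integrable_bound)
  show "integrable lebesgue2 (\<lambda>q. 2 powr p * (energy_density s p A u q + energy_density s p A v q))"
    using assms by auto
  show "energy_density s p A (\<lambda>x. u x - v x) \<in> borel_measurable lebesgue2"
    by (rule energy_density_measurable) measurable
  show "AE q in lebesgue2. norm (energy_density s p A (\<lambda>x. u x - v x) q)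
      \<le> norm (2 powr p * (energy_density s p A u q + energy_density s p A v q))"
    using energy_density_diff_le[OF assms(1), of s A u v]
    by (auto simp: energy_density_nonneg)
qed

text \<open>Young's inequality in crude form: both factors are bounded by the larger base.\<close>

lemma J_mult_le:
  assumes "1 < p"
  shows "\<bar>J p u x y * d\<bar> \<le> \<bar>u x - u y\<bar> powr p + \<bar>d\<bar> powr p"
proof -
  define a where "a = max \<bar>u x - u y\<bar> \<bar>d\<bar>"
  have "\<bar>J p u x y * d\<bar> = \<bar>u x - u y\<bar> powr (p - 1) * \<bar>d\<bar>"
    by (simp add: J_eq_signed_power abs_mult abs_signed_power)
  also have "\<dots> \<le> a powr (p - 1) * a"
    using assms by (intro mult_mono powr_mono2) (auto simp: a_def)
  also have "\<dots> = a powr p"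
    by (cases "a = 0") (auto simp: a_def powr_diff)
  also have "\<dots> \<le> \<bar>u x - u y\<bar> powr p + \<bar>d\<bar> powr p"
    by (auto simp: a_def max_def)
  finally show ?thesis .
qed

definition p_laplacian_integrand ::
    "real \<Rightarrow> real \<Rightarrow> (real ^ 'n::finite \<Rightarrow> real) \<Rightarrow> (real ^ 'n \<Rightarrow> real) \<Rightarrow> (real ^ 'n) \<times> (real ^ 'n) \<Rightarrow> real" where
  "p_laplacian_integrand s p u \<phi> =
     (\<lambda>(x, y). J p u x y * (\<phi> x - \<phi> y) * kernel (real CARD('n) + s * p) (x - y))"

text \<open>Finite energy of \<open>u\<close> on \<open>U\<close> alone is enough, since the integrand vanishes when neither point lies in the
  support of \<open>\<phi>\<close>. Absolute integrability is what allows the iterated integral defining the operator to be treated as an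
  integral over the product.\<close>

lemma integrable_p_laplacian_integrand:
  fixes u \<phi> :: "real ^ 'n::finite \<Rightarrow> real"
  assumes p: "1 < p" and [measurable]: "u \<in> borel_measurable lebesgue" "\<phi> \<in> borel_measurable lebesgue"
    and U: "integrable lebesgue2 (energy_density s p U u)"
    and \<phi>: "integrable lebesgue2 (energy_density s p UNIV \<phi>)" and supp: "\<And>x. x \<notin> U \<Longrightarrow> \<phi> x = 0"
  shows "integrable lebesgue2 (p_laplacian_integrand s p u \<phi>)"
proof (rule Bochner_Integration.integrable_bound)
  let ?b = "\<lambda>q. energy_density s p U u q + (\<lambda>(x, y). energy_density s p U u (y, x)) q + energy_density s p UNIV \<phi> q"
  show "integrable lebesgue2 ?b"
    using U \<phi> by (intro Bochner_Integration.integrable_add lebesgue_pair.integrable_product_swap)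
  show "p_laplacian_integrand s p u \<phi> \<in> borel_measurable lebesgue2"
    unfolding p_laplacian_integrand_def J_def by measurable
  have "\<bar>p_laplacian_integrand s p u \<phi> (x, y)\<bar> \<le> ?b (x, y)" for x y
  proof (cases "x \<in> U \<or> y \<in> U")
    case True
    let ?k = "kernel (real CARD('n) + s * p) (x - y)"
    have "\<bar>p_laplacian_integrand s p u \<phi> (x, y)\<bar> = \<bar>J p u x y * (\<phi> x - \<phi> y)\<bar> * ?k"
      by (simp add: p_laplacian_integrand_def abs_mult kernel_nonneg)
    also have "\<dots> \<le> (\<bar>u x - u y\<bar> powr p + \<bar>\<phi> x - \<phi> y\<bar> powr p) * ?k"
      by (intro mult_right_mono J_mult_le p kernel_nonneg)
    also have "\<dots> = \<bar>u x - u y\<bar> powr p * ?k + energy_density s p UNIV \<phi> (x, y)"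
      by (simp add: energy_density_def algebra_simps)
    also have "\<bar>u x - u y\<bar> powr p * ?k \<le> energy_density s p U u (x, y) + energy_density s p U u (y, x)"
      using True kernel_minus_commute[of "real CARD('n) + s * p" x y]
      by (auto simp: energy_density_def abs_minus_commute kernel_nonneg indicator_def)
    finally show ?thesis by simp
  next
    case False
    then have "p_laplacian_integrand s p u \<phi> (x, y) = 0" by (simp add: p_laplacian_integrand_def supp)
    then show ?thesis by (simp add: energy_density_nonneg)
  qed
  then show "AE q in lebesgue2. norm (p_laplacian_integrand s p u \<phi> q) \<le> norm (?b q)"
    by (auto simp: energy_density_nonneg)
qed

lemma frac_p_laplacian_eq_integral:
  assumes "integrable lebesgue2 (p_laplacian_integrand s p u \<phi>)"
  shows "frac_p_laplacian s p u \<phi> = integral\<^sup>L lebesgue2 (p_laplacian_integrand s p u \<phi>)"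
  unfolding lebesgue_pair.integral_fst'[OF assms, symmetric]
  by (simp add: frac_p_laplacian_def p_laplacian_integrand_def kernel_def)

section \<open>The test function\<close>

text \<open>The data of the comparison argument, apart from the equation itself: \<open>M\<close> bounds \<open>u\<close>, and the degenerate cases \<open>M = 0\<close> and
  \<open>|U| = 0\<close> are excluded because the constants below involve negative powers of both.\<close>

locale reflected_comparison =
  fixes s p M :: real and k :: "'n::finite" and U :: "(real ^ 'n) set" and u :: "real ^ 'n \<Rightarrow> real"
  assumes s: "0 < s" and p: "1 < p" "p < 2" and M: "0 < M"
    and U: "U \<in> lmeasurable" "U \<subseteq> half_space k" "0 < measure lebesgue U"
    and u_measurable [measurable]: "u \<in> borel_measurable lebesgue"
    and u_bounded: "AE x in lebesgue. \<bar>u x\<bar> \<le> M"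
    and u_energy: "gagliardo_integral s p U u < \<infinity>" "gagliardo_integral s p (reflect k ` U) u < \<infinity>"
    and u_order: "AE x in lebesgue. x \<in> half_space k - U \<longrightarrow> reflect_fun k u x \<le> u x"
begin

abbreviation v :: "real ^ 'n \<Rightarrow> real" where "v \<equiv> reflect_fun k u"
abbreviation K :: "real ^ 'n \<Rightarrow> real" where "K \<equiv> kernel (real CARD('n) + s * p)"
abbreviation H :: "(real ^ 'n) set" where "H \<equiv> half_space k"

text \<open>The negative part of \<open>u - u*\<close>, cut off outside \<open>U\<close>. The ordering outside \<open>U\<close> makes the cut-off invisible almost
  everywhere on the half space (lemma \<open>\<phi>_on_half_space\<close>), so no jump is created there.\<close>

definition \<phi> :: "real ^ 'n \<Rightarrow> real" where
  "\<phi> x = indicator U x * max (v x - u x) 0"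

text \<open>The points at which every almost-everywhere hypothesis holds, both at the point and at its mirror image. Invariance under
  reflection lets a pair of points be moved into the half space.\<close>

definition generic_point :: "real ^ 'n \<Rightarrow> bool" where
  "generic_point x \<longleftrightarrow> \<bar>u x\<bar> \<le> M \<and> \<bar>v x\<bar> \<le> M \<and> x $ k \<noteq> 0 \<and>
     (x \<in> H - U \<longrightarrow> v x \<le> u x) \<and> (reflect k x \<in> H - U \<longrightarrow> u x \<le> v x)"

lemma v_measurable [measurable]: "v \<in> borel_measurable lebesgue"
  unfolding reflect_fun_def by measurable

lemma U_sets [measurable]: "U \<in> sets lebesgue"
  using U(1) by (rule fmeasurableD)

lemma \<phi>_measurable [measurable]: "\<phi> \<in> borel_measurable lebesgue"
  unfolding \<phi>_def by measurable

lemma \<phi>_nonneg: "0 \<le> \<phi> x"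
  by (simp add: \<phi>_def)

lemma \<phi>_outside: "x \<notin> U \<Longrightarrow> \<phi> x = 0"
  by (simp add: \<phi>_def)

lemma v_reflect: "v (reflect k x) = u x" and u_reflect: "u (reflect k x) = v x"
  by (simp_all add: reflect_fun_def)

lemma reflect_half_space_iff: "x $ k \<noteq> 0 \<Longrightarrow> reflect k x \<in> H \<longleftrightarrow> x \<notin> H"
  by (auto simp: half_space_def reflect_nth)

lemma generic_point_reflect: "generic_point (reflect k x) \<longleftrightarrow> generic_point x"
  by (auto simp: generic_point_def v_reflect u_reflect reflect_nth)

lemma AE_generic_point: "AE x in lebesgue. generic_point x"
proof -
  have "negligible {x::real^'n. axis k 1 \<bullet> x = 0}"
    by (rule negligible_hyperplane) (simp add: axis_eq_0_iff)
  then have "AE x::real^'n in lebesgue. x $ k \<noteq> 0"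
    by (intro AE_I'[of "{x. axis k 1 \<bullet> x = 0}"]) (auto simp: negligible_iff_null_sets inner_axis')
  with u_bounded AE_reflect[OF u_bounded, of k] u_order AE_reflect[OF u_order, of k]
  show ?thesis
    by eventually_elim (auto simp: generic_point_def reflect_fun_def)
qed

lemma AE_generic_point_pair: "AE q in lebesgue2. generic_point (fst q) \<and> generic_point (snd q)"
  using AE_lebesgue_pair_fst[OF AE_generic_point] AE_lebesgue_pair_snd[OF AE_generic_point] by eventually_elim simp

lemma \<phi>_on_half_space:
  assumes "generic_point x" "x \<in> H"
  shows "\<phi> x = max (v x - u x) 0"
  using assms by (auto simp: \<phi>_def generic_point_def indicator_def)

lemma \<phi>_off_half_space: "x \<notin> H \<Longrightarrow> \<phi> x = 0"
  using U(2) by (auto intro: \<phi>_outside)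

lemma exponent_nonneg: "0 \<le> real CARD('n) + s * p"
  using s p by simp

lemma kernel_reflect_le:
  assumes "x \<in> H" "y \<in> H" "x \<noteq> y"
  shows "K (x - reflect k y) \<le> K (x - y)"
  using assms norm_diff_le_norm_diff_reflect[of x k y]
  by (intro kernel_mono exponent_nonneg) (auto simp: half_space_def)

lemma integrable_u_v:
  "integrable lebesgue2 (energy_density s p U u)" "integrable lebesgue2 (energy_density s p U v)"
proof -
  have R: "reflect k ` U = reflect k -` U \<inter> space lebesgue"
    by (auto simp: reflect_image_iff)
  have [measurable]: "reflect k ` U \<in> sets lebesgue"
    unfolding R by measurable
  show "integrable lebesgue2 (energy_density s p U u)"
    using u_energy(1) by (subst (asm) gagliardo_integral_finite_iff) auto
  show "integrable lebesgue2 (energy_density s p U v)"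
    using u_energy(2) by (intro integrable_energy_density_reflect, subst (asm) gagliardo_integral_finite_iff) auto
qed

lemma integrable_w: "integrable lebesgue2 (energy_density s p U (\<lambda>x. u x - v x))"
  by (rule integrable_energy_density_diff[OF _ u_measurable v_measurable U_sets integrable_u_v])
    (use p in simp)

text \<open>For \<open>y\<close> in the half space, \<open>\<phi>\<close> is the negative part of \<open>w = u - u*\<close> at both points and taking negative parts contracts
  differences. For \<open>y\<close> below the hyperplane, \<open>\<phi> y = 0\<close> and \<open>w\<close> has opposite signs at \<open>y\<close> and \<open>y*\<close>: comparing \<open>x\<close> with the
  one where \<open>w\<close> is nonnegative bounds \<open>\<phi> x\<close> by a difference of \<open>w\<close>, and \<open>y*\<close> is closer to \<open>x\<close> than \<open>y\<close>.\<close>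

lemma \<phi>_energy_bound:
  assumes x: "x \<in> U" and y: "generic_point y" and gx: "generic_point x"
  defines "D \<equiv> \<lambda>x y. energy_density s p U (\<lambda>x. u x - v x) (x, y)"
  shows "\<bar>\<phi> x - \<phi> y\<bar> powr p * K (x - y) \<le> D x y + D x (reflect k y)"
proof -
  define w where "w = (\<lambda>x. u x - v x)"
  have D: "D x z = \<bar>w x - w z\<bar> powr p * K (x - z)" for z
    using x by (simp add: D_def w_def energy_density_def)
  have Dnn: "0 \<le> D x z" for z by (simp add: D_def energy_density_nonneg)
  have wr: "w (reflect k z) = - w z" for z by (simp add: w_def v_reflect u_reflect)
  have xH: "x \<in> H" using x U(2) by auto
  have \<phi>x: "\<phi> x = max (- w x) 0" using \<phi>_on_half_space[OF gx xH] by (simp add: w_def)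
  have le: "\<bar>a\<bar> powr p * K z \<le> \<bar>b\<bar> powr p * K z'" if "\<bar>a\<bar> \<le> \<bar>b\<bar>" "K z \<le> K z'" for a b z z'
    using that p by (intro mult_mono powr_mono2) (auto simp: kernel_nonneg)
  show ?thesis
  proof (cases "y \<in> H")
    case True
    then have "\<phi> y = max (- w y) 0" using \<phi>_on_half_space[OF y True] by (simp add: w_def)
    then have "\<bar>\<phi> x - \<phi> y\<bar> \<le> \<bar>w x - w y\<bar>" using \<phi>x by (auto simp: max_def)
    then show ?thesis using le[of "\<phi> x - \<phi> y" "w x - w y" "x - y" "x - y"] Dnn[of "reflect k y"] by (simp add: D)
  next
    case False
    then have \<phi>y: "\<phi> y = 0" and yH: "reflect k y \<in> H"
      using y reflect_half_space_iff[of y] by (auto simp: generic_point_def \<phi>_off_half_space)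
    consider "0 < w y" | "w y \<le> 0" "x = reflect k y" | "w y \<le> 0" "x \<noteq> reflect k y" by linarith
    then show ?thesis
    proof cases
      case 1
      then have "\<bar>\<phi> x - \<phi> y\<bar> \<le> \<bar>w x - w y\<bar>" using \<phi>x \<phi>y by (auto simp: max_def)
      then show ?thesis using le[of "\<phi> x - \<phi> y" "w x - w y" "x - y" "x - y"] Dnn[of "reflect k y"] by (simp add: D)
    next
      \<comment> \<open>The kernel vanishes at \<open>x - y* = 0\<close> and dominates nothing, but here antisymmetry of \<open>w\<close> gives \<open>0 \<le> w x\<close>.\<close>
      case 2
      then have "\<phi> x = 0" using \<phi>x wr[of y] by simp
      then show ?thesis using \<phi>y Dnn[of y] Dnn[of "reflect k y"] by simp
    next
      case 3
      have "K (x - y) \<le> K (x - reflect k y)"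
        using kernel_reflect_le[OF xH yH 3(2)] by simp
      moreover have "\<bar>\<phi> x - \<phi> y\<bar> \<le> \<bar>w x - w (reflect k y)\<bar>" using 3 \<phi>x \<phi>y by (auto simp: max_def wr)
      ultimately show ?thesis
        using le[of "\<phi> x - \<phi> y" "w x - w (reflect k y)" "x - y" "x - reflect k y"] Dnn[of y] by (simp add: D)
    qed
  qed
qed

lemma integrable_\<phi>: "integrable lebesgue2 (energy_density s p UNIV \<phi>)"
proof (rule Bochner_Integration.integrable_bound)
  let ?D = "energy_density s p U (\<lambda>x. u x - v x)"
  define B where "B = (\<lambda>q. ?D q + (\<lambda>(x, y). ?D (x, reflect k y)) q)"
  have B: "integrable lebesgue2 B"
    unfolding B_def by (intro Bochner_Integration.integrable_add integrable_w integrable_reflect_snd)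
  have Bnn: "0 \<le> B q" for q by (simp add: B_def energy_density_nonneg case_prod_unfold)
  let ?b = "\<lambda>q. B q + (\<lambda>(x, y). B (y, x)) q"
  show "integrable lebesgue2 ?b"
    by (intro Bochner_Integration.integrable_add B lebesgue_pair.integrable_product_swap)
  show "energy_density s p UNIV \<phi> \<in> borel_measurable lebesgue2"
    by (rule energy_density_measurable) auto
  show "AE q in lebesgue2. norm (energy_density s p UNIV \<phi> q) \<le> norm (?b q)"
    using AE_generic_point_pair
  proof eventually_elim
    case (elim q)
    obtain x y where q: "q = (x, y)" by fastforce
    have E: "energy_density s p UNIV \<phi> (x, y) = \<bar>\<phi> x - \<phi> y\<bar> powr p * K (x - y)"
      by (simp add: energy_density_def)
    have "energy_density s p UNIV \<phi> (x, y) \<le> B (x, y) + B (y, x)"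
    proof (cases "x \<in> U \<or> y \<in> U")
      case True
      then show ?thesis
      proof
        assume "x \<in> U"
        then show ?thesis unfolding E using \<phi>_energy_bound[of x y] elim Bnn[of "(y, x)"] by (simp add: q B_def)
      next
        assume "y \<in> U"
        then show ?thesis unfolding E using \<phi>_energy_bound[of y x] elim Bnn[of "(x, y)"]
          by (simp add: q B_def abs_minus_commute kernel_minus_commute[of _ x y])
      qed
    next
      case False
      then show ?thesis using Bnn[of "(x, y)"] Bnn[of "(y, x)"] by (simp add: E \<phi>_outside)
    qed
    then show ?case by (simp add: q energy_density_nonneg Bnn)
  qed
qed

lemma \<phi>_bounded: "AE x in lebesgue. \<phi> x \<le> 2 * M"
  using AE_generic_point by eventually_elim (use M in \<open>auto simp: \<phi>_def generic_point_def indicator_def\<close>)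

lemma integrable_\<phi>_powr:
  assumes r: "0 < r"
  shows "integrable lebesgue (\<lambda>x. \<bar>\<phi> x\<bar> powr r)"
proof (rule Bochner_Integration.integrable_bound)
  show "integrable lebesgue (\<lambda>x. (2 * M) powr r * indicator U x :: real)"
    using U(1) by (intro integrable_mult_right) (auto simp: fmeasurable_def)
  show "AE x in lebesgue. norm (\<bar>\<phi> x\<bar> powr r) \<le> norm ((2 * M) powr r * indicator U x :: real)"
    using \<phi>_bounded
  proof eventually_elim
    case (elim x)
    then show ?case using M r \<phi>_nonneg[of x] by (cases "x \<in> U") (auto simp: \<phi>_outside intro!: powr_mono2)
  qed
qed measurable

lemma \<phi>_Wsp0: "\<phi> \<in> Wsp0 s p U"
proof -
  have "gagliardo_integral s p UNIV \<phi> < \<infinity>"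
    using integrable_\<phi> by (subst gagliardo_integral_finite_iff) auto
  then show ?thesis
    using integrable_\<phi>_powr[of p] p by (auto simp: Wsp0_def Wsp_def Lp_def \<phi>_outside)
qed

section \<open>Coercivity under reflection\<close>

text \<open>The integrand of \<open>\<langle>(-\<Delta>) u - (-\<Delta>) u*, \<phi>\<rangle>\<close> for the fractional p-Laplacian.\<close>

definition operator_gap :: "(real ^ 'n) \<times> (real ^ 'n) \<Rightarrow> real" where
  "operator_gap q = p_laplacian_integrand s p u \<phi> q - p_laplacian_integrand s p v \<phi> q"

lemma operator_gap_eq:
  "operator_gap (x, y) = (signed_power p (u x - u y) - signed_power p (v x - v y)) * (\<phi> x - \<phi> y) * K (x - y)"
  by (simp add: operator_gap_def p_laplacian_integrand_def J_eq_signed_power algebra_simps)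

lemma operator_gap_integral:
  "integrable lebesgue2 operator_gap"
  "integral\<^sup>L lebesgue2 operator_gap = frac_p_laplacian s p u \<phi> - frac_p_laplacian s p v \<phi>"
proof -
  have 1: "integrable lebesgue2 (p_laplacian_integrand s p u \<phi>)"
    by (rule integrable_p_laplacian_integrand[OF p(1) _ _ integrable_u_v(1) integrable_\<phi> \<phi>_outside]) measurable
  have 2: "integrable lebesgue2 (p_laplacian_integrand s p v \<phi>)"
    by (rule integrable_p_laplacian_integrand[OF p(1) _ _ integrable_u_v(2) integrable_\<phi> \<phi>_outside]) measurable
  show "integrable lebesgue2 operator_gap"
    unfolding operator_gap_def using 1 2 by simp
  show "integral\<^sup>L lebesgue2 operator_gap = frac_p_laplacian s p u \<phi> - frac_p_laplacian s p v \<phi>"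
    unfolding operator_gap_def frac_p_laplacian_eq_integral[OF 1] frac_p_laplacian_eq_integral[OF 2]
    using 1 2 by (rule Bochner_Integration.integral_diff)
qed

text \<open>The integrand summed over the orbit of a pair under reflection of either point. Since reflections preserve the measure, this
  multiplies the integral by four; it brings together the pairs whose contributions have to be compared pointwise.\<close>

definition orbit_sum :: "(real ^ 'n) \<times> (real ^ 'n) \<Rightarrow> real" where
  "orbit_sum = (\<lambda>(x, y). operator_gap (x, y) + operator_gap (reflect k x, y) + operator_gap (x, reflect k y) + operator_gap (reflect k x, reflect k y))"

lemma orbit_sum_integral: "integrable lebesgue2 orbit_sum" "integral\<^sup>L lebesgue2 orbit_sum = 4 * integral\<^sup>L lebesgue2 operator_gap"
proof -
  note F = operator_gap_integral(1)
  note F1 = integrable_reflect_fst[OF F, of k]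
  note F2 = integrable_reflect_snd[OF F, of k]
  note F12 = integrable_reflect_snd[OF F1(1), of k]
  have G: "orbit_sum = (\<lambda>q. operator_gap q + (\<lambda>(x, y). operator_gap (reflect k x, y)) q + (\<lambda>(x, y). operator_gap (x, reflect k y)) q
      + (\<lambda>(x, y). (\<lambda>(x, y). operator_gap (reflect k x, y)) (x, reflect k y)) q)"
    by (auto simp: orbit_sum_def)
  show "integrable lebesgue2 orbit_sum"
    unfolding G by (intro Bochner_Integration.integrable_add F F1 F2 F12)
  show "integral\<^sup>L lebesgue2 orbit_sum = 4 * integral\<^sup>L lebesgue2 operator_gap"
    unfolding G
    by (subst Bochner_Integration.integral_add,
        (intro Bochner_Integration.integrable_add F F1(1) F2(1) F12(1))+)+
      (use F1(2) F2(2) F12(2) in simp)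
qed

text \<open>The quadratic energy density of \<open>\<phi>\<close> between \<open>U\<close> and its complement in the half space. There \<open>\<phi>\<close> vanishes
  at the second point, so the difference of \<open>\<phi>\<close> is just \<open>\<phi> x\<close> and integration over \<open>y\<close> only concerns the kernel.\<close>

definition exit_energy :: "(real ^ 'n) \<times> (real ^ 'n) \<Rightarrow> real" where
  "exit_energy = (\<lambda>(x, y). (\<phi> x)\<^sup>2 * (indicator (H - U) y * K (x - y)))"

definition coercivity :: real where "coercivity = (p - 1) * (2 * M) powr (p - 2)"

text \<open>Both \<open>\<phi>\<close> and the kernel simplify on the orbit: \<open>\<phi>\<close> vanishes at \<open>x*\<close> and \<open>y*\<close>, and \<open>x* - y\<close> is as long as \<open>x - y*\<close>. What
  remains is the expression of the two pointwise estimates.\<close>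

lemma orbit_sum_upper_bound_half_space:
  assumes g: "generic_point x" "generic_point y" and H: "x \<in> H" "y \<in> H"
  shows "orbit_sum (x, y) \<le> - (coercivity * exit_energy (x, y))"
proof -
  have off: "\<phi> (reflect k x) = 0" "\<phi> (reflect k y) = 0"
    using H g by (auto intro!: \<phi>_off_half_space simp: reflect_half_space_iff generic_point_def)
  have KK: "K (reflect k x - y) = K (x - reflect k y)"
    by (simp add: kernel_def norm_reflect_diff)
  have G: "orbit_sum (x, y) = (signed_power p (u x - u y) - signed_power p (v x - v y)) * (\<phi> x - \<phi> y) * K (x - y)
      + (signed_power p (u x - v y) - signed_power p (v x - u y)) * (\<phi> x + \<phi> y) * K (x - reflect k y)"
    unfolding orbit_sum_def prod.case operator_gap_eq off v_reflect u_reflect KK by (simp add: ring_distribs)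
  have \<phi>: "\<phi> x = max (v x - u x) 0" "\<phi> y = max (v y - u y) 0"
    using g H by (auto intro: \<phi>_on_half_space)
  have kk: "K (x - reflect k y) \<le> K (x - y) \<or> (u x = u y \<and> v x = v y)"
    using kernel_reflect_le[OF H] by blast
  show ?thesis
  proof (cases "x \<in> U \<and> y \<in> H - U")
    case True
    then have le: "K (x - reflect k y) \<le> K (x - y)" using H by (intro kernel_reflect_le) auto
    have vy: "v y \<le> u y" using True g by (auto simp: generic_point_def)
    then have "\<phi> y = 0" using \<phi> by simp
    then show ?thesis
      using paired_energy_density_coercive[OF p _ _ _ _ kernel_nonneg le vy, of "u x" M "v x"] g True
      unfolding G \<phi>(1) by (simp add: generic_point_def exit_energy_def coercivity_def \<phi>(1) mult.assoc)
  next
    case False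
    then have "exit_energy (x, y) = 0" by (auto simp: exit_energy_def \<phi>_outside)
    then show ?thesis
      using paired_energy_density_nonpos[OF p kernel_nonneg kk] unfolding G \<phi> by simp
  qed
qed

lemma orbit_sum_reflect: "orbit_sum (reflect k x, y) = orbit_sum (x, y)" "orbit_sum (x, reflect k y) = orbit_sum (x, y)"
  unfolding orbit_sum_def prod.case reflect_reflect by simp_all

lemma coercivity_pos: "0 < coercivity"
  unfolding coercivity_def using p M by (intro mult_pos_pos) auto

lemma exit_energy_nonneg: "0 \<le> exit_energy q"
  by (cases q) (simp add: exit_energy_def kernel_nonneg)

lemma orbit_sum_upper_bound:
  assumes g: "generic_point x" "generic_point y"
  shows "orbit_sum (x, y) \<le> - (coercivity * exit_energy (x, y))"
proof -
  define x' y' where "x' = (if x \<in> H then x else reflect k x)" and "y' = (if y \<in> H then y else reflect k y)"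
  have "x $ k \<noteq> 0" "y $ k \<noteq> 0" using g by (simp_all add: generic_point_def)
  then have "x' \<in> H" "y' \<in> H" by (simp_all add: x'_def y'_def reflect_half_space_iff)
  moreover have "generic_point x'" "generic_point y'" using g by (simp_all add: x'_def y'_def generic_point_reflect)
  ultimately have *: "orbit_sum (x', y') \<le> - (coercivity * exit_energy (x', y'))" by (intro orbit_sum_upper_bound_half_space)
  have "orbit_sum (x', y') = orbit_sum (x, y)" by (simp add: x'_def y'_def orbit_sum_reflect)
  moreover have "exit_energy (x, y) \<le> exit_energy (x', y')"
  proof (cases "x \<in> H \<and> y \<in> H")
    case False
    then have "exit_energy (x, y) = 0" by (auto simp: exit_energy_def \<phi>_off_half_space)
    then show ?thesis by (simp add: exit_energy_nonneg)
  qed (simp add: x'_def y'_def)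
  then have "coercivity * exit_energy (x, y) \<le> coercivity * exit_energy (x', y')" using coercivity_pos by simp
  ultimately show ?thesis using * by linarith
qed

lemma half_space_measurable [measurable]: "H \<in> sets lebesgue"
proof -
  have "open H" unfolding half_space_def by (rule open_halfspace_component_gt_cart)
  then show ?thesis by auto
qed

lemma exit_energy_measurable [measurable]: "exit_energy \<in> borel_measurable lebesgue2"
  unfolding exit_energy_def by measurable

lemma integrable_exit_energy: "integrable lebesgue2 exit_energy"
proof (rule Bochner_Integration.integrable_bound)
  show "integrable lebesgue2 (\<lambda>q. orbit_sum q / coercivity)" using orbit_sum_integral(1) by simp
  show "AE q in lebesgue2. norm (exit_energy q) \<le> norm (orbit_sum q / coercivity)"
    using AE_generic_point_pair
  proof eventually_elim
    case (elim q)
    then have "coercivity * exit_energy q \<le> - orbit_sum q" using orbit_sum_upper_bound[of "fst q" "snd q"] by simp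
    then have "exit_energy q \<le> \<bar>orbit_sum q\<bar> / coercivity" using coercivity_pos by (subst pos_le_divide_eq) (auto simp: mult.commute)
    then show ?case using coercivity_pos exit_energy_nonneg[of q] by simp
  qed
qed measurable

lemma operator_gap_integral_le: "4 * integral\<^sup>L lebesgue2 operator_gap \<le> - (coercivity * integral\<^sup>L lebesgue2 exit_energy)"
proof -
  have "integral\<^sup>L lebesgue2 orbit_sum \<le> (\<integral>q. - (coercivity * exit_energy q) \<partial>lebesgue2)"
  proof (rule integral_mono_AE)
    show "AE q in lebesgue2. orbit_sum q \<le> - (coercivity * exit_energy q)"
      using AE_generic_point_pair
    proof eventually_elim
      case (elim q)
      then show ?case using orbit_sum_upper_bound[of "fst q" "snd q"] by simp
    qed
  qed (use orbit_sum_integral integrable_exit_energy in auto)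
  then show ?thesis by (simp add: orbit_sum_integral)
qed

lemma integrable_\<phi>_square: "integrable lebesgue (\<lambda>x. (\<phi> x)\<^sup>2)"
  using integrable_\<phi>_powr[of 2] by (simp add: \<phi>_nonneg powr_numeral)

definition exit_rate :: real where
  "exit_rate = ball_constant CARD('n) (s * p) * measure lebesgue U powr - (s * p / real CARD('n))"

text \<open>Integrate in \<open>y\<close> first: for \<open>x\<close> in \<open>U\<close> the kernel has mass at least \<open>exit_rate\<close> on the complement of \<open>U\<close> in the
  half space, and for other \<open>x\<close> both sides vanish.\<close>

lemma exit_energy_integral_ge: "exit_rate * (LINT x|lebesgue. (\<phi> x)\<^sup>2) \<le> integral\<^sup>L lebesgue2 exit_energy"
proof -
  have exit_rate: "0 \<le> exit_rate" by (simp add: exit_rate_def ball_constant_def)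
  have "ennreal (exit_rate * (LINT x|lebesgue. (\<phi> x)\<^sup>2)) = (\<integral>\<^sup>+x. ennreal ((\<phi> x)\<^sup>2) * ennreal exit_rate \<partial>lebesgue)"
  proof -
    have "(\<integral>\<^sup>+x. ennreal ((\<phi> x)\<^sup>2) \<partial>lebesgue) = ennreal (LINT x|lebesgue. (\<phi> x)\<^sup>2)"
      by (rule nn_integral_eq_integral[OF integrable_\<phi>_square]) simp
    then show ?thesis using exit_rate
      by (subst nn_integral_multc) (measurable, simp add: ennreal_mult mult.commute)
  qed
  also have "\<dots> \<le> (\<integral>\<^sup>+x. \<integral>\<^sup>+y. ennreal (exit_energy (x, y)) \<partial>lebesgue \<partial>lebesgue)"
  proof (rule nn_integral_mono)
    fix x :: "real ^ 'n"
    show "ennreal ((\<phi> x)\<^sup>2) * ennreal exit_rate \<le> (\<integral>\<^sup>+y. ennreal (exit_energy (x, y)) \<partial>lebesgue)"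
    proof (cases "x \<in> U")
      case True
      then have "0 < x $ k" using U(2) by (auto simp: half_space_def)
      then have "ennreal exit_rate \<le> (\<integral>\<^sup>+y\<in>H - U. ennreal (K (x - y)) \<partial>lebesgue)"
        unfolding exit_rate_def using half_space_kernel_lower_bound[OF U(1,3), of x k "s * p"] s p by simp
      then have "ennreal ((\<phi> x)\<^sup>2) * ennreal exit_rate \<le> ennreal ((\<phi> x)\<^sup>2) * (\<integral>\<^sup>+y\<in>H - U. ennreal (K (x - y)) \<partial>lebesgue)"
        by (rule mult_left_mono) simp
      also have "\<dots> = (\<integral>\<^sup>+y. ennreal ((\<phi> x)\<^sup>2) * (ennreal (K (x - y)) * indicator (H - U) y) \<partial>lebesgue)"
        by (rule nn_integral_cmult[symmetric]) measurable
      also have "\<dots> = (\<integral>\<^sup>+y. ennreal (exit_energy (x, y)) \<partial>lebesgue)"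
        by (intro nn_integral_cong) (auto simp: exit_energy_def ennreal_mult kernel_nonneg split: split_indicator)
      finally show ?thesis .
    qed (simp add: \<phi>_outside)
  qed
  also have "\<dots> = (\<integral>\<^sup>+q. ennreal (exit_energy q) \<partial>lebesgue2)"
    by (rule lebesgue.nn_integral_fst) measurable
  also have "\<dots> = ennreal (integral\<^sup>L lebesgue2 exit_energy)"
    by (rule nn_integral_eq_integral[OF integrable_exit_energy]) (simp add: exit_energy_nonneg)
  finally show ?thesis by (simp add: integral_nonneg exit_energy_nonneg)
qed

lemma energy_le: "coercivity * exit_rate * (LINT x|lebesgue. (\<phi> x)\<^sup>2)
    \<le> 4 * (frac_p_laplacian s p v \<phi> - frac_p_laplacian s p u \<phi>)"
proof -
  have "coercivity * (exit_rate * (LINT x|lebesgue. (\<phi> x)\<^sup>2)) \<le> coercivity * integral\<^sup>L lebesgue2 exit_energy"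
    using exit_energy_integral_ge coercivity_pos by simp
  then show ?thesis using operator_gap_integral_le unfolding operator_gap_integral(2) by (simp add: mult.assoc)
qed

text \<open>On \<open>U\<close> one has \<open>(u - u*) \<phi> = - \<phi>^2\<close>, so the equation tested with \<open>\<phi>\<close> bounds
  \<open>\<langle>(-\<Delta>) u* - (-\<Delta>) u, \<phi>\<rangle>\<close> from above by \<open>A\<close> times the integral of \<open>\<phi>^2\<close>. Coercivity bounds it from below by \<open>coercivity exit_rate / 4\<close> times the same integral.\<close>

lemma comparison:
  assumes sol: "weak_solution s p k U V u"
    and V: "AE x in lebesgue. x \<in> U \<longrightarrow> V x \<le> A"
    and small: "4 * A < coercivity * exit_rate"
  shows "AE x in lebesgue. x \<in> U \<longrightarrow> v x \<le> u x"
proof -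
  define I where "I = (LINT x|lebesgue. (\<phi> x)\<^sup>2)"
  have I: "0 \<le> I" by (simp add: I_def integral_nonneg)
  have Vint: "integrable lebesgue (\<lambda>x. indicator U x *\<^sub>R (V x * (u x - v x) * \<phi> x))"
    using sol \<phi>_Wsp0 unfolding weak_solution_def in_Wsp0_dual_def set_integrable_def by blast
  have ineq: "frac_p_laplacian s p u \<phi> - frac_p_laplacian s p v \<phi> \<ge> (LINT x:U|lebesgue. V x * (u x - v x) * \<phi> x)"
    using sol \<phi>_Wsp0 \<phi>_nonneg unfolding weak_solution_def by simp
  have "(LINT x|lebesgue. - (A * (\<phi> x)\<^sup>2)) \<le> (LINT x:U|lebesgue. V x * (u x - v x) * \<phi> x)"
    unfolding set_lebesgue_integral_def
  proof (rule integral_mono_AE)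
    show "AE x in lebesgue. - (A * (\<phi> x)\<^sup>2) \<le> indicator U x *\<^sub>R (V x * (u x - v x) * \<phi> x)"
      using V
    proof eventually_elim
      case (elim x)
      show ?case
      proof (cases "x \<in> U")
        case True
        then have "(u x - v x) * \<phi> x = - (\<phi> x)\<^sup>2"
          by (auto simp: \<phi>_def max_def power2_eq_square algebra_simps)
        then have "indicator U x *\<^sub>R (V x * (u x - v x) * \<phi> x) = - (V x * (\<phi> x)\<^sup>2)"
          using True by (simp add: mult.assoc)
        also have "\<dots> \<ge> - (A * (\<phi> x)\<^sup>2)" using elim True by (simp add: mult_right_mono)
        finally show ?thesis .
      qed (simp add: \<phi>_outside)
    qed
  qed (use Vint integrable_\<phi>_square in auto)
  then have "coercivity * exit_rate * I \<le> 4 * A * I"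
    using energy_le ineq unfolding I_def by simp
  then have "(coercivity * exit_rate - 4 * A) * I \<le> 0" by (simp add: algebra_simps)
  then have "I = 0" using small I by (simp add: mult_le_0_iff)
  then have "AE x in lebesgue. (\<phi> x)\<^sup>2 = 0"
    unfolding I_def by (subst (asm) integral_nonneg_eq_0_iff_AE) (auto simp: integrable_\<phi>_square)
  then show ?thesis
    by eventually_elim (auto simp: \<phi>_def max_def split: if_splits)
qed

end

section \<open>The comparison theorem\<close>

lemma Linfty_AE_bound:
  assumes f: "f \<in> Linfty A" and A: "A \<in> sets lebesgue"
  shows "AE x in lebesgue. x \<in> A \<longrightarrow> \<bar>f x\<bar> \<le> enn2real (Linfty_norm A f)"
proof -
  have fin: "Linfty_norm A f < top" using f by (simp add: Linfty_def)
  have "AE x in lebesgue_on A. ennreal \<bar>f x\<bar> \<le> Linfty_norm A f"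
    unfolding Linfty_norm_def by (rule esssup_AE)
  then have "AE x in lebesgue. x \<in> A \<longrightarrow> ennreal \<bar>f x\<bar> \<le> Linfty_norm A f"
    using A by (subst (asm) AE_restrict_space_iff) auto
  then show ?thesis
  proof eventually_elim
    case (elim x)
    show ?case
    proof
      assume "x \<in> A"
      then have "enn2real (ennreal \<bar>f x\<bar>) \<le> enn2real (Linfty_norm A f)"
        using elim fin by (intro enn2real_mono) auto
      then show "\<bar>f x\<bar> \<le> enn2real (Linfty_norm A f)" by simp
    qed
  qed
qed

theorem theorem1p1:
  fixes s p :: real
  assumes "0 < s" and "s < 1" and "1 < p" and "p < 2"
  shows "\<exists>C>0. \<forall>(k::'n::finite) (U::(real ^ 'n) set) (V::real ^ 'n \<Rightarrow> real) (u::real ^ 'n \<Rightarrow> real).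
    open U \<and> bounded U \<and> U \<subseteq> half_space k \<and>
    V \<in> L1_loc_on U \<and> (\<lambda>x. max (V x) 0) \<in> Linfty U \<and>
    u \<in> Wsp_tilde s p U \<inter> Wsp_tilde s p (reflect k ` U) \<inter> Linfty UNIV \<and>
    weak_solution s p k U V u \<and>
    measure lebesgue U powr (s * p / real CARD('n))
      * enn2real (Linfty_norm U (\<lambda>x. max (V x) 0))
      * enn2real (Linfty_norm UNIV u) powr (2 - p) < C
    \<longrightarrow> (AE x in lebesgue. x \<in> U \<longrightarrow> u x \<ge> reflect_fun k u x)"
proof -
  define N where "N = CARD('n)"
  \<comment> \<open>This is \<open>coercivity * exit_rate\<close> without its powers of \<open>M\<close> and \<open>|U|\<close>; the \<open>4\<close> counts the pairs in an orbit.\<close>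
  define C where "C = (p - 1) * 2 powr (p - 2) * ball_constant N (s * p) / 4"
  have "0 < N" by (simp add: N_def)
  then have "0 < C" using assms by (simp add: C_def ball_constant_pos)
  moreover have "AE x in lebesgue. x \<in> U \<longrightarrow> reflect_fun k u x \<le> u x"
    if U: "open U" "bounded U" "U \<subseteq> half_space k"
      and V: "(\<lambda>x. max (V x) 0) \<in> Linfty U"
      and u: "u \<in> Wsp_tilde s p U" "u \<in> Wsp_tilde s p (reflect k ` U)" "u \<in> Linfty UNIV"
      and sol: "weak_solution s p k U V u"
      and small: "measure lebesgue U powr (s * p / real N)
        * enn2real (Linfty_norm U (\<lambda>x. max (V x) 0)) * enn2real (Linfty_norm UNIV u) powr (2 - p) < C"
    for k :: 'n and U V u
  proof -
    define m where "m = measure lebesgue U"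
    define A where "A = enn2real (Linfty_norm U (\<lambda>x. max (V x) 0))"
    define M where "M = enn2real (Linfty_norm UNIV u)"
    have lm: "U \<in> lmeasurable" using U by (simp add: lmeasurable_open)
    have uM: "AE x in lebesgue. \<bar>u x\<bar> \<le> M"
      using Linfty_AE_bound[OF u(3)] by (simp add: M_def)
    have VA: "AE x in lebesgue. x \<in> U \<longrightarrow> V x \<le> A"
      using Linfty_AE_bound[OF V fmeasurableD[OF lm]] unfolding A_def[symmetric] by eventually_elim auto
    have M0: "0 \<le> M" and m0: "0 \<le> m" by (simp_all add: M_def m_def)
    show ?thesis
    proof (cases "m = 0 \<or> M = 0")
      case True
      then show ?thesis
      proof
        assume "m = 0"
        then have "U \<in> null_sets lebesgue"
          using lm by (simp add: m_def null_sets_def emeasure_eq_measure2 fmeasurableD)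
        from AE_not_in[OF this] show ?thesis by eventually_elim simp
      next
        assume "M = 0"
        with uM AE_reflect[OF uM, of k] show ?thesis by eventually_elim (use \<open>M = 0\<close> in \<open>simp add: reflect_fun_def\<close>)
      qed
    next
      case False
      then have M: "0 < M" and m: "0 < m" using M0 m0 by auto
      interpret reflected_comparison s p M k U u
        using assms M m lm U uM u sol
        by unfold_locales (auto simp: m_def Wsp_tilde_def Lp_loc_def weak_solution_def)
      have "4 * A < coercivity * exit_rate"
      proof -
        define a b where "a = m powr (s * p / real N)" and "b = M powr (2 - p)"
        have ab: "0 < a" "0 < b" using m M by (simp_all add: a_def b_def)
        have "(2 * M) powr (p - 2) = 2 powr (p - 2) / b"
          using M powr_minus_divide[of M "2 - p"] by (simp add: powr_mult b_def)
        moreover have "m powr - (s * p / real N) = 1 / a"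
          by (simp add: a_def powr_minus_divide)
        ultimately have "coercivity * exit_rate = 4 * C / (a * b)"
          by (simp add: coercivity_def exit_rate_def C_def N_def[symmetric] m_def[symmetric])
        moreover have "a * A * b < C" using small by (simp add: a_def b_def A_def M_def m_def)
        ultimately show ?thesis using ab by (simp add: pos_less_divide_eq mult_ac)
      qed
      then show ?thesis by (rule comparison[OF sol VA])
    qed
  qed
  ultimately show ?thesis unfolding N_def by (intro exI[of _ C]) auto
qed

end
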